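(* For every integer $k\ge 1$, $$\frac12=\frac{1}{4k+2}+\sum_{l=1}^{k}\sum_{n=1}^{\infty}\frac{(2k)!}{(2k+1-2l)!\,(n\pi)^{2l}}(-1)^{l-1}.$$
   Context: Here $\sum_{n=1}^{\infty}c_n$ denotes the limit of partial sums $\lim_{N\to\infty}\sum_{n=1}^{N}c_n$ of a series of real numbers. *)

theory Defs
  imports "HOL-Analysis.Analysis"
begin

end

theory Submission
  imports Defs "HOL-Computational_Algebra.Formal_Power_Series"
    "HOL-Complex_Analysis.Cauchy_Integral_Formula"
begin

text \<open>
  With \<open>S l = (\<Sum>n. 1 / ((n + 1) * pi) ^ (2 * l))\<close> and after division by \<open>(2 * k)!\<close>, the claim becomes
  \[ \frac{k}{(2k+1)!} = \sum_{l=1}^{k} (-1)^{l-1} \frac{S_l}{(2k+1-2l)!} . \]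
  This is Newton's identity \<open>k e\<^sub>k = \<Sum>l. (-1)^(l-1) p\<^sub>l e\<^sub>k\<^sub>-\<^sub>l\<close> between power sums and elementary
  symmetric functions of the infinitely many numbers \<open>a n = 1 / ((n + 1) * pi) ^ 2\<close>: the power sums
  are the \<open>S l\<close>, and Euler's product \<open>sinh x / x = (\<Prod>n. 1 + a n * x\<^sup>2)\<close>, compared with the Taylor
  series of \<open>sinh\<close>, says that the \<open>j\<close>-th elementary symmetric function is \<open>1 / (2 * j + 1)!\<close>.

  The only analytic issue is that the elementary symmetric functions of the first \<open>N\<close> of the \<open>a n\<close>
  tend to the Taylor coefficients of the infinite product (\<open>elem_sym_tendsto\<close>). Working
  with \<open>sinh\<close> in place of \<open>sin\<close> makes all terms nonnegative, so that monotone limits suffice.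
  Newton's identity for finitely many numbers (\<open>elem_sym_newton\<close>) then passes to the limit.
\<close>

section \<open>Newton's identities for finitely many numbers\<close>

text \<open>The coefficients are the elementary symmetric functions of \<open>a 0, \<dots>, a (N - 1)\<close>.\<close>

definition elem_sym_fps :: "(nat \<Rightarrow> real) \<Rightarrow> nat \<Rightarrow> real fps" where
  "elem_sym_fps a N = (\<Prod>n<N. 1 + fps_const (a n) * fps_X)"

lemma elem_sym_fps_0 [simp]: "elem_sym_fps a 0 = 1"
  by (simp add: elem_sym_fps_def)

lemma elem_sym_fps_Suc:
  "elem_sym_fps a (Suc N) = elem_sym_fps a N * (1 + fps_const (a N) * fps_X)"
  by (simp add: elem_sym_fps_def)

lemma elem_sym_Suc_nth:
  "fps_nth (elem_sym_fps a (Suc N)) k =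
     fps_nth (elem_sym_fps a N) k + a N * (if k = 0 then 0 else fps_nth (elem_sym_fps a N) (k - 1))"
proof -
  have "elem_sym_fps a (Suc N) =
      elem_sym_fps a N + fps_const (a N) * (elem_sym_fps a N * fps_X)"
    by (simp add: elem_sym_fps_Suc algebra_simps)
  then show ?thesis
    by simp
qed

text \<open>This is \<open>c X / (1 + c X)\<close>, that is, \<open>X\<close> times the logarithmic derivative of the factor
  \<open>1 + c X\<close>. Summing it over \<open>c = a n\<close> produces the power sums as coefficients.\<close>

definition alternating_powers_fps :: "real \<Rightarrow> real fps" where
  "alternating_powers_fps c = Abs_fps (\<lambda>i. if i = 0 then 0 else (- 1) ^ (i - 1) * c ^ i)"

lemma alternating_powers_fps_mult:
  "(1 + fps_const c * fps_X) * alternating_powers_fps c = fps_const c * fps_X"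
proof (rule fps_ext)
  fix n
  show "fps_nth ((1 + fps_const c * fps_X) * alternating_powers_fps c) n = fps_nth (fps_const c * fps_X) n"
  proof (cases n)
    case 0
    then show ?thesis by (simp add: alternating_powers_fps_def)
  next
    case (Suc m)
    then show ?thesis
      by (cases m) (simp_all add: alternating_powers_fps_def distrib_right mult.assoc)
  qed
qed

lemma elem_sym_fps_log_deriv:
  "fps_X * fps_deriv (elem_sym_fps a N) = elem_sym_fps a N * (\<Sum>n<N. alternating_powers_fps (a n))"
proof (induction N)
  case 0
  then show ?case by simp
next
  case (Suc N)
  let ?P = "elem_sym_fps a N" and ?L = "1 + fps_const (a N) * fps_X"
  have "fps_X * fps_deriv (elem_sym_fps a (Suc N))
      = (fps_X * fps_deriv ?P) * ?L + ?P * (fps_const (a N) * fps_X)"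
    by (simp add: elem_sym_fps_Suc algebra_simps)
  also have "\<dots> = ?P * (\<Sum>n<N. alternating_powers_fps (a n)) * ?L + ?P * (?L * alternating_powers_fps (a N))"
    by (simp only: Suc.IH alternating_powers_fps_mult)
  also have "\<dots> = elem_sym_fps a (Suc N) * (\<Sum>n<Suc N. alternating_powers_fps (a n))"
    by (simp add: elem_sym_fps_Suc algebra_simps)
  finally show ?case .
qed

text \<open>Comparison of coefficients in the formula for the logarithmic derivative.\<close>

lemma elem_sym_newton:
  "real k * fps_nth (elem_sym_fps a N) k =
     (\<Sum>l=1..k. (- 1) ^ (l - 1) * (\<Sum>n<N. a n ^ l) * fps_nth (elem_sym_fps a N) (k - l))"
proof -
  have "real k * fps_nth (elem_sym_fps a N) k = fps_nth (fps_X * fps_deriv (elem_sym_fps a N)) k"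
    by (cases k) auto
  also have "\<dots> = fps_nth ((\<Sum>n<N. alternating_powers_fps (a n)) * elem_sym_fps a N) k"
    by (simp only: elem_sym_fps_log_deriv mult.commute)
  also have "\<dots> = (\<Sum>l=0..k. fps_nth (\<Sum>n<N. alternating_powers_fps (a n)) l
      * fps_nth (elem_sym_fps a N) (k - l))"
    by (rule fps_mult_nth)
  also have "\<dots> = (\<Sum>l=1..k. fps_nth (\<Sum>n<N. alternating_powers_fps (a n)) l
      * fps_nth (elem_sym_fps a N) (k - l))"
    by (intro sum.mono_neutral_right) (auto simp: fps_sum_nth alternating_powers_fps_def)
  also have "\<dots> = (\<Sum>l=1..k. (- 1) ^ (l - 1) * (\<Sum>n<N. a n ^ l)
      * fps_nth (elem_sym_fps a N) (k - l))"
    by (intro sum.cong) (auto simp: fps_sum_nth alternating_powers_fps_def sum_distrib_left)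
  finally show ?thesis .
qed

section \<open>Passage to infinitely many numbers\<close>

lemma elem_sym_sums:
  "(\<lambda>k. fps_nth (elem_sym_fps a N) k * s ^ k) sums (\<Prod>n<N. 1 + a n * s)"
proof (induction N)
  case 0
  have "(\<lambda>k. fps_nth (1 :: real fps) k * s ^ k) = (\<lambda>k. if k = 0 then 1 else 0)"
    by (auto simp: fun_eq_iff)
  then show ?case
    using sums_single[of 0 "\<lambda>_. 1 :: real"] by simp
next
  case (Suc N)
  let ?e = "\<lambda>k. fps_nth (elem_sym_fps a N) k"
  let ?Q = "\<Prod>n<N. 1 + a n * s"
  let ?h = "\<lambda>k. if k = 0 then 0 else ?e (k - 1) * s ^ k"
  have "(\<lambda>k. ?h (Suc k)) sums (s * ?Q)"
    using sums_mult[OF Suc.IH, of s] by (simp add: algebra_simps)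
  then have "?h sums (s * ?Q)"
    using sums_Suc_iff[of ?h "s * ?Q"] by simp
  then have "(\<lambda>k. ?e k * s ^ k + a N * ?h k) sums (?Q + a N * (s * ?Q))"
    by (intro sums_add sums_mult Suc.IH)
  moreover have "(\<lambda>k. ?e k * s ^ k + a N * ?h k) =
      (\<lambda>k. fps_nth (elem_sym_fps a (Suc N)) k * s ^ k)"
    by (auto simp: fun_eq_iff elem_sym_Suc_nth algebra_simps)
  ultimately show ?case
    by (simp add: algebra_simps)
qed

lemma elem_sym_nonneg:
  assumes "\<And>n. a n \<ge> 0"
  shows "fps_nth (elem_sym_fps a N) k \<ge> 0"
  by (induction N arbitrary: k) (auto simp: elem_sym_Suc_nth assms)

lemma elem_sym_incseq:
  assumes "\<And>n. a n \<ge> 0"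
  shows "incseq (\<lambda>N. fps_nth (elem_sym_fps a N) k)"
  by (intro incseq_SucI) (simp add: elem_sym_Suc_nth assms elem_sym_nonneg)

text \<open>Agreement on \<open>s \<ge> 0\<close> suffices: a power series that is not identically zero has isolated
  zeros, whereas the difference of the two series vanishes at points arbitrarily close to \<open>0\<close>.\<close>

lemma powser_unique_right:
  fixes b c :: "nat \<Rightarrow> real"
  assumes b: "\<And>s. s \<ge> 0 \<Longrightarrow> (\<lambda>k. b k * s ^ k) sums F s"
    and c: "\<And>s. s \<ge> 0 \<Longrightarrow> (\<lambda>k. c k * s ^ k) sums F s"
  shows "b = c"
proof (rule ccontr)
  assume "b \<noteq> c"
  then obtain m where m: "b m - c m \<noteq> 0"
    by (auto simp: fun_eq_iff)
  have zero: "b 0 - c 0 = 0"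
    using b[of 0] c[of 0] by (simp add: powser_sums_zero_iff)
  with m have "m > 0"
    by (cases m) auto
  define g where "g x = (\<Sum>k. (b k - c k) * x ^ k)" for x
  have sums0: "(\<lambda>k. (b k - c k) * s ^ k) sums 0" if "s \<ge> 0" for s
    using sums_diff[OF b[OF that] c[OF that]] by (simp add: left_diff_distrib)
  have g_sums: "(\<lambda>k. (b k - c k) * (x - 0) ^ k) sums g x" if "norm (x - 0) < 1" for x
    using powser_inside[of "\<lambda>k. b k - c k" 1 x] sums0[of 1] that
    by (auto simp: g_def sums_iff)
  have "g 0 = 0"
    using zero by (simp add: g_def)
  from powser_0_nonzero[of 1 0 "\<lambda>k. b k - c k" g m, OF _ g_sums this m \<open>m > 0\<close>]
  obtain r where "r > 0" and r: "\<And>z. z \<in> cball 0 r - {0} \<Longrightarrow> g z \<noteq> 0"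
    by auto
  have "g r = 0"
    using sums0[of r] \<open>r > 0\<close> by (simp add: g_def sums_iff)
  with r[of r] \<open>r > 0\<close> show False
    by simp
qed

text \<open>For \<open>a n \<ge> 0\<close> the coefficients of the partial products increase with \<open>N\<close>; let \<open>L k\<close> be their
  limits. For \<open>s \<ge> 0\<close> every finite piece of \<open>\<Sum>k. L k * s ^ k\<close> is a limit of pieces of partial
  products and hence at most \<open>F s\<close>, while every partial product is at most \<open>\<Sum>k. L k * s ^ k\<close>.
  So this series equals \<open>F s\<close>, and uniqueness of power series gives \<open>L = E\<close>.\<close>

lemma elem_sym_tendsto:
  assumes nonneg: "\<And>n. a n \<ge> 0"
    and prod: "\<And>s. s \<ge> 0 \<Longrightarrow> (\<lambda>N. \<Prod>n<N. 1 + a n * s) \<longlonglongrightarrow> F s"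
    and E: "\<And>s. s \<ge> 0 \<Longrightarrow> (\<lambda>k. E k * s ^ k) sums F s"
  shows "(\<lambda>N. fps_nth (elem_sym_fps a N) k) \<longlonglongrightarrow> E k"
proof -
  let ?e = "\<lambda>N k. fps_nth (elem_sym_fps a N) k"
  have prod_le: "(\<Prod>n<N. 1 + a n * s) \<le> F s" if "s \<ge> 0" for N s
  proof (rule incseq_le[OF _ prod[OF that]])
    show "incseq (\<lambda>N. \<Prod>n<N. 1 + a n * s)"
    proof (rule incseq_SucI)
      fix N
      have "(\<Prod>n<N. 1 + a n * s) \<ge> 0"
        using nonneg that by (intro prod_nonneg) auto
      then show "(\<Prod>n<N. 1 + a n * s) \<le> (\<Prod>n<Suc N. 1 + a n * s)"
        using nonneg[of N] that by (simp add: mult_le_cancel_left1)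
    qed
  qed
  have finite_le: "(\<Sum>k<K. ?e N k * s ^ k) \<le> F s" if "s \<ge> 0" for N K s
  proof -
    have "(\<Sum>k<K. ?e N k * s ^ k) \<le> (\<Prod>n<N. 1 + a n * s)"
      using sum_le_suminf[of "\<lambda>k. ?e N k * s ^ k" "{..<K}"] elem_sym_sums[of a N s]
        elem_sym_nonneg[OF nonneg] that
      by (simp add: sums_iff)
    then show ?thesis
      using prod_le[OF that] by (rule order_trans)
  qed
  have "\<exists>l. (\<lambda>N. ?e N k) \<longlonglongrightarrow> l" for k
  proof -
    have "?e N k \<le> F 1" for N
    proof -
      have "?e N k \<le> (\<Sum>j<Suc k. ?e N j * 1 ^ j)"
        by (simp add: sum_nonneg elem_sym_nonneg nonneg)
      also have "\<dots> \<le> F 1"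
        by (rule finite_le) simp
      finally show ?thesis .
    qed
    then obtain l where "(\<lambda>N. ?e N k) \<longlonglongrightarrow> l"
      using incseq_convergent[OF elem_sym_incseq[of a k, OF nonneg], of "F 1"] by blast
    then show ?thesis ..
  qed
  then obtain L where L: "\<And>k. (\<lambda>N. ?e N k) \<longlonglongrightarrow> L k"
    by metis
  have e_le: "?e N k \<le> L k" for N k
    by (rule incseq_le[OF elem_sym_incseq[OF nonneg] L])
  have L_nonneg: "L k \<ge> 0" for k
    by (rule order_trans[OF elem_sym_nonneg[OF nonneg] e_le[of 0]])
  have "(\<lambda>k. L k * s ^ k) sums F s" if s: "s \<ge> 0" for s
  proof -
    have bound: "(\<Sum>k<K. L k * s ^ k) \<le> F s" for K
    proof (rule LIMSEQ_le_const2)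
      show "(\<lambda>N. \<Sum>k<K. ?e N k * s ^ k) \<longlonglongrightarrow> (\<Sum>k<K. L k * s ^ k)"
        by (intro tendsto_intros L)
    qed (use finite_le[OF s] in blast)
    have summable: "summable (\<lambda>k. L k * s ^ k)"
      by (rule summableI_nonneg_bounded[OF _ bound]) (use L_nonneg s in simp)
    have "(\<Prod>n<N. 1 + a n * s) \<le> (\<Sum>k. L k * s ^ k)" for N
    proof -
      have "(\<Sum>k. ?e N k * s ^ k) \<le> (\<Sum>k. L k * s ^ k)"
        by (intro suminf_le summable mult_right_mono e_le)
           (use s elem_sym_sums[of a N s] in \<open>auto simp: sums_iff\<close>)
      then show ?thesis
        using elem_sym_sums[of a N s] by (simp add: sums_iff)
    qed
    then have "F s \<le> (\<Sum>k. L k * s ^ k)"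
      by (intro LIMSEQ_le_const2[OF prod[OF s]]) blast
    moreover have "(\<Sum>k. L k * s ^ k) \<le> F s"
      by (rule suminf_le_const[OF summable bound])
    ultimately show ?thesis
      using summable by (simp add: sums_iff)
  qed
  then have "L = E"
    using E by (rule powser_unique_right)
  with L show ?thesis
    by simp
qed

text \<open>Newton's identity of index \<open>k\<close> involves only finitely many power sums and coefficients,
  so it survives the termwise limit \<open>N \<rightarrow> \<infinity>\<close>.\<close>

lemma infinite_newton:
  assumes nonneg: "\<And>n. a n \<ge> 0"
    and prod: "\<And>s. s \<ge> 0 \<Longrightarrow> (\<lambda>N. \<Prod>n<N. 1 + a n * s) \<longlonglongrightarrow> F s"
    and E: "\<And>s. s \<ge> 0 \<Longrightarrow> (\<lambda>k. E k * s ^ k) sums F s"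
    and summable: "\<And>l. l \<ge> 1 \<Longrightarrow> summable (\<lambda>n. a n ^ l)"
  shows "real k * E k = (\<Sum>l=1..k. (- 1) ^ (l - 1) * (\<Sum>n. a n ^ l) * E (k - l))"
proof (rule LIMSEQ_unique)
  note lim = elem_sym_tendsto[of a F E, OF nonneg prod E]
  show "(\<lambda>N. real k * fps_nth (elem_sym_fps a N) k) \<longlonglongrightarrow> real k * E k"
    by (intro tendsto_intros lim)
  show "(\<lambda>N. real k * fps_nth (elem_sym_fps a N) k)
      \<longlonglongrightarrow> (\<Sum>l=1..k. (- 1) ^ (l - 1) * (\<Sum>n. a n ^ l) * E (k - l))"
    unfolding elem_sym_newton
    by (intro tendsto_intros lim summable_LIMSEQ summable) auto
qed

section \<open>Euler's product for the hyperbolic sine\<close>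

text \<open>Euler's product for \<open>sin (pi * z)\<close> at the imaginary point \<open>z = \<i> * x / pi\<close>.\<close>

lemma sinh_product_formula:
  fixes x :: real
  shows "(\<lambda>N. x * (\<Prod>n<N. 1 + 1 / (real (Suc n) * pi) ^ 2 * x ^ 2)) \<longlonglongrightarrow> sinh x"
proof -
  define z where "z = \<i> * complex_of_real (x / pi)"
  have factor: "1 - z\<^sup>2 / (of_nat (Suc n))\<^sup>2 =
      complex_of_real (1 + 1 / (real (Suc n) * pi) ^ 2 * x ^ 2)" for n
    by (simp add: z_def power_mult_distrib power_divide del: of_nat_Suc)
  have "(\<Prod>k=1..N. 1 - z\<^sup>2 / (of_nat k)\<^sup>2) =
      complex_of_real (\<Prod>n<N. 1 + 1 / (real (Suc n) * pi) ^ 2 * x ^ 2)" for N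
    unfolding of_real_prod factor[symmetric]
    using prod.atLeast1_atMost_eq[of "\<lambda>k. 1 - z\<^sup>2 / (of_nat k)\<^sup>2" N] by simp
  moreover have pz: "of_real pi * z = \<i> * complex_of_real x"
    by (simp add: z_def)
  ultimately have prod_lim: "(\<lambda>N. \<i> * complex_of_real x
        * complex_of_real (\<Prod>n<N. 1 + 1 / (real (Suc n) * pi) ^ 2 * x ^ 2))
      \<longlonglongrightarrow> sin (\<i> * complex_of_real x)"
    using sin_product_formula_complex[of z] by simp
  have i_cancel: "- \<i> * (\<i> * complex_of_real x * complex_of_real y) = complex_of_real (x * y)" for y
    by (simp add: complex_eq_iff)
  from prod_lim have "(\<lambda>N. - \<i> * (\<i> * complex_of_real x
        * complex_of_real (\<Prod>n<N. 1 + 1 / (real (Suc n) * pi) ^ 2 * x ^ 2)))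
      \<longlonglongrightarrow> sinh (complex_of_real x)"
    unfolding sinh_conv_sin by (rule tendsto_mult_left)
  moreover have "sinh (complex_of_real x) = complex_of_real (sinh x)"
    by (simp add: sinh_field_def exp_of_real exp_minus)
  ultimately
  have "(\<lambda>N. complex_of_real (x * (\<Prod>n<N. 1 + 1 / (real (Suc n) * pi) ^ 2 * x ^ 2)))
      \<longlonglongrightarrow> complex_of_real (sinh x)"
    by (simp only: i_cancel)
  then show ?thesis
    by (simp only: tendsto_of_real_iff)
qed

lemma sinh_odd_sums:
  fixes x :: real
  shows "(\<lambda>k. x ^ (2 * k + 1) / fact (2 * k + 1)) sums sinh x"
proof -
  let ?g = "\<lambda>n. if even n then 0 else x ^ n /\<^sub>R fact n"
  have "(\<lambda>k. ?g (2 * k + 1)) sums sinh x \<longleftrightarrow> ?g sums sinh x"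
    by (rule sums_mono_reindex) (auto simp: strict_mono_def elim!: oddE)
  with sinh_converges[of x] show ?thesis
    by (simp add: field_simps)
qed

text \<open>Since \<open>sinh x / x\<close> is even, it is a power series in \<open>s = x\<^sup>2\<close>; its product and its Taylor
  series in this variable are the two inputs to Newton's identity. The value at \<open>s = 0\<close> is the
  limit \<open>1\<close>.\<close>

lemma sinh_sqrt_product:
  fixes s :: real
  assumes "s \<ge> 0"
  shows "(\<lambda>N. \<Prod>n<N. 1 + 1 / (real (Suc n) * pi) ^ 2 * s)
    \<longlonglongrightarrow> (if s = 0 then 1 else sinh (sqrt s) / sqrt s)"
proof (cases "s = 0")
  case False
  with tendsto_divide[OF sinh_product_formula[of "sqrt s"] tendsto_const[of "sqrt s"]] assms
  show ?thesis by (simp del: of_nat_Suc)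
qed simp

lemma sinh_sqrt_sums:
  fixes s :: real
  assumes "s \<ge> 0"
  shows "(\<lambda>k. 1 / fact (2 * k + 1) * s ^ k)
    sums (if s = 0 then 1 else sinh (sqrt s) / sqrt s)"
proof (cases "s = 0")
  case True
  then show ?thesis
    using powser_sums_zero[of "\<lambda>k. 1 / fact (2 * k + 1) :: real"] by simp
next
  case False
  with assms have "sqrt s ^ (2 * k + 1) / fact (2 * k + 1) / sqrt s
      = 1 / fact (2 * k + 1) * s ^ k" for k
    by (simp add: power_mult)
  with sums_divide[OF sinh_odd_sums[of "sqrt s"], of "sqrt s"] False show ?thesis
    by simp
qed

section \<open>The identity\<close>

lemma summable_inverse_even_power:
  assumes "l \<ge> 1"
  shows "summable (\<lambda>n. 1 / (real (Suc n) * pi) ^ (2 * l))"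
proof -
  have "summable (\<lambda>n. inverse (real (Suc n) ^ (2 * l)))"
    using inverse_power_summable[of "2 * l", where 'a = real] assms
    by (subst summable_Suc_iff) simp
  from summable_mult[OF this, of "1 / pi ^ (2 * l)"] show ?thesis
    by (simp add: power_mult_distrib field_simps del: of_nat_Suc)
qed

theorem theorem1p2:
  fixes k :: nat
  assumes "k \<ge> 1"
  shows "(\<forall>l\<in>{1..k}. summable (\<lambda>n::nat. fact (2 * k) / (fact (2 * k + 1 - 2 * l) * (real (Suc n) * pi) ^ (2 * l)) * (- 1) ^ (l - 1)))
    \<and> (1 / 2 :: real) = 1 / (4 * real k + 2)
        + (\<Sum>l = 1..k. \<Sum>n::nat. fact (2 * k) / (fact (2 * k + 1 - 2 * l) * (real (Suc n) * pi) ^ (2 * l)) * (- 1) ^ (l - 1))"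
proof -
  let ?t = "\<lambda>l n. fact (2 * k) / (fact (2 * k + 1 - 2 * l) * (real (Suc n) * pi) ^ (2 * l)) * (- 1) ^ (l - 1)"
  let ?c = "\<lambda>l. fact (2 * k) / fact (2 * k + 1 - 2 * l) * (- 1) ^ (l - 1) :: real"
  let ?p = "\<lambda>l n. 1 / (real (Suc n) * pi) ^ (2 * l)"
  have t_eq: "?t l n = ?c l * ?p l n" for l n
    by simp
  have "real k * (1 / fact (2 * k + 1)) =
      (\<Sum>l=1..k. (- 1) ^ (l - 1) * (\<Sum>n. (1 / (real (Suc n) * pi) ^ 2) ^ l)
        * (1 / fact (2 * (k - l) + 1)))"
  proof (rule infinite_newton[OF _ sinh_sqrt_product sinh_sqrt_sums])
    show "summable (\<lambda>n. (1 / (real (Suc n) * pi) ^ 2) ^ l)" if "l \<ge> 1" for l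
      using summable_inverse_even_power[OF that]
      by (simp add: power_divide power_mult del: of_nat_Suc)
  qed auto
  also have "\<dots> = (\<Sum>l=1..k. (- 1) ^ (l - 1) * suminf (?p l) * (1 / fact (2 * k + 1 - 2 * l)))"
    by (intro sum.cong refl)
       (simp add: power_divide power_mult Suc_diff_le diff_mult_distrib2 del: of_nat_Suc)
  finally have newton: "real k * (1 / fact (2 * k + 1)) =
    (\<Sum>l=1..k. (- 1) ^ (l - 1) * suminf (?p l) * (1 / fact (2 * k + 1 - 2 * l)))" .
  have "(\<Sum>l=1..k. suminf (?t l)) = (\<Sum>l=1..k. ?c l * suminf (?p l))"
    unfolding t_eq
    by (intro sum.cong refl suminf_mult summable_inverse_even_power) auto
  also have "\<dots> = fact (2 * k) * (real k * (1 / fact (2 * k + 1)))"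
    unfolding newton sum_distrib_left by (intro sum.cong refl) simp
  also have "\<dots> = real k / (2 * real k + 1)"
  proof -
    have "fact (2 * k + 1) = (2 * real k + 1) * fact (2 * k)"
      by simp
    then show ?thesis
      by (simp del: fact_Suc)
  qed
  finally have "(1 / 2 :: real) = 1 / (4 * real k + 2) + (\<Sum>l=1..k. suminf (?t l))"
    by (simp add: field_simps)
  moreover have "summable (?t l)" if "l \<in> {1..k}" for l
    unfolding t_eq using that by (intro summable_mult summable_inverse_even_power) simp
  ultimately show ?thesis
    by blast
qed

end
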